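(* Let $\mathcal{H}_{\mathsf A}$ and $\mathcal{H}_{\mathsf B}$ be finite-dimensional Hilbert spaces, let $X$ be a Hermitian operator on $\mathcal{H}_{\mathsf A}$ and $Y$ a Hermitian operator on $\mathcal{H}_{\mathsf A}\otimes\mathcal{H}_{\mathsf B}$. Then, for real $t$ in a neighborhood of $0$ in which $I+tX$ and $I+tY$ are positive definite, $$\operatorname{tr}_{\mathsf B}\big((I+tX)\star(I+tY)\big)=(I+tX)\star\operatorname{tr}_{\mathsf B}(I+tY)+O(t^3)\qquad(t\to0).$$
   Context: For positive definite operators $\rho,\sigma$ on the same finite-dimensional Hilbert space, $\rho\star\sigma=\exp(\log\rho+\log\sigma)$ (matrix exponential and logarithm). If the operators act on different spaces they are first embedded into the smallest common tensor product space by tensoring with identities; thus on the left-hand side $I+tX$ stands for $(I+tX)\otimes I_{\mathsf B}$, whereas on the right-hand side the $\star$-product is taken on $\mathcal{H}_{\mathsf A}$. $\operatorname{tr}_{\mathsf B}$ is the partial trace over $\mathcal{H}_{\mathsf B}$. The $O(t^3)$ term is operator-valued (in any norm). *)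

theory Defs
  imports "HOL-Analysis.Analysis" "HOL-Library.Landau_Symbols"
begin

text \<open>
  A Hilbert space of dimension \<open>CARD('n)\<close> is represented, after the choice of an orthonormal basis
  indexed by \<open>'n\<close>, as \<^typ>\<open>complex ^ 'n\<close>; operators on it are the matrices
  \<^typ>\<open>complex ^ 'n ^ 'n\<close>. The tensor product of the spaces with index types \<open>'a\<close> and \<open>'b\<close> is the
  space with index type \<^typ>\<open>'a \<times> 'b\<close>.
\<close>

type_synonym 'n cmat = "complex ^ 'n ^ 'n"

definition adj :: "'n::finite cmat \<Rightarrow> 'n cmat"
  where "adj A = (\<chi> i j. cnj (A $ j $ i))"

definition hermitian :: "'n::finite cmat \<Rightarrow> bool"
  where "hermitian A \<longleftrightarrow> adj A = A"

definition cscalar :: "complex ^ 'n::finite \<Rightarrow> complex ^ 'n \<Rightarrow> complex"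
  where "cscalar u v = (\<Sum>i\<in>UNIV. cnj (u $ i) * v $ i)"

text \<open>For Hermitian \<open>A\<close> the number \<open>cscalar v (A *v v)\<close> is real, so \<^const>\<open>Re\<close> loses nothing.\<close>

definition pos_def :: "'n::finite cmat \<Rightarrow> bool"
  where "pos_def A \<longleftrightarrow> hermitian A \<and> (\<forall>v. v \<noteq> 0 \<longrightarrow> 0 < Re (cscalar v (A *v v)))"

definition mpow :: "'n::finite cmat \<Rightarrow> nat \<Rightarrow> 'n cmat"
  where "mpow A k = (((**) A) ^^ k) (mat 1)"

definition mexp :: "'n::finite cmat \<Rightarrow> 'n cmat"
  where "mexp A = (\<Sum>k. mpow A k /\<^sub>R fact k)"

text \<open>
  The exponential is a bijection from the Hermitian onto the positive definite matrices; the
  logarithm of a positive definite matrix is the value of the inverse bijection. On other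
  arguments \<open>mlog\<close> is unspecified.
\<close>

definition mlog :: "'n::finite cmat \<Rightarrow> 'n cmat"
  where "mlog A = (THE H. hermitian H \<and> mexp H = A)"

definition star_prod :: "'n::finite cmat \<Rightarrow> 'n cmat \<Rightarrow> 'n cmat"  (infixl "\<star>" 70)
  where "A \<star> B = mexp (mlog A + mlog B)"

definition tensor :: "'a::finite cmat \<Rightarrow> 'b::finite cmat \<Rightarrow> ('a \<times> 'b) cmat"  (infixl "\<otimes>\<^sub>M" 75)
  where "A \<otimes>\<^sub>M B = (\<chi> p q. A $ fst p $ fst q * B $ snd p $ snd q)"

definition ptrace_B :: "('a::finite \<times> 'b::finite) cmat \<Rightarrow> 'a cmat"
  where "ptrace_B Z = (\<chi> i j. \<Sum>k\<in>UNIV. Z $ (i, k) $ (j, k))"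

end

theory Submission
  imports Defs
begin

text \<open>
  For Hermitian \<open>X\<close>, \<open>Y\<close> one has \<open>log (1 + tX) = tX - t\<^sup>2X\<^sup>2/2 + O(t\<^sup>3)\<close>, and exponentiating the sum of
  two such logarithms gives \<open>(1 + tX) \<star> (1 + tY) = 1 + t(X + Y) + t\<^sup>2(XY + YX)/2 + O(t\<^sup>3)\<close>: the
  squares cancel. Each term on the right is compatible with \<^const>\<open>ptrace_B\<close>, as \<open>X\<close> acts on the first
  factor only and occurs together with \<open>Y\<close> at most linearly. On the other side
  \<open>ptrace_B (1 + tY) = d (1 + t ptrace_B Y / d)\<close> with \<open>d\<close> the dimension of the traced-out space, and
  \<open>\<star>\<close> is homogeneous with respect to positive scalars.
  That \<^const>\<open>mlog\<close> is well defined is shown without the spectral theorem: if \<open>exp A = exp B\<close> for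
  Hermitian \<open>A\<close>, \<open>B\<close>, then uniqueness of positive square roots gives \<open>exp (A/2\<^sup>n) = exp (B/2\<^sup>n)\<close> for
  all \<open>n\<close>, and \<open>exp\<close> is injective near \<open>0\<close>.
\<close>

subsection \<open>Exponential estimates in a Banach algebra\<close>

text \<open>The telescoping identity in the proof keeps \<open>A\<close> on the left and
  \<open>B\<close> on the right, so no commutativity is involved.\<close>

lemma norm_power_diff_le:
  fixes A B :: "'a::real_normed_algebra_1"
  assumes "norm A \<le> r" "norm B \<le> r"
  shows "norm (A ^ Suc k - B ^ Suc k) \<le> real (Suc k) * r ^ k * norm (A - B)"
proof (induction k)
  case 0
  then show ?case by simp
next
  case (Suc k)
  have r: "0 \<le> r" using assms(1) norm_ge_zero order_trans by blast
  have "A ^ Suc (Suc k) - B ^ Suc (Suc k) = A * (A ^ Suc k - B ^ Suc k) + (A - B) * B ^ Suc k"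
    by (simp add: algebra_simps)
  also have "norm \<dots> \<le> norm A * norm (A ^ Suc k - B ^ Suc k) + norm (A - B) * norm B ^ Suc k"
    by (intro order_trans[OF norm_triangle_ineq] add_mono order_trans[OF norm_mult_ineq]
        mult_left_mono norm_power_ineq) auto
  also have "\<dots> \<le> r * (real (Suc k) * r ^ k * norm (A - B)) + norm (A - B) * r ^ Suc k"
    using assms r by (intro add_mono mult_mono Suc.IH power_mono) auto
  also have "\<dots> = real (Suc (Suc k)) * r ^ Suc k * norm (A - B)"
    by (simp add: algebra_simps)
  finally show ?case .
qed

text \<open>Subtracting the linear part removes the first two terms of the series. In each later
  term the factor \<open>n + 2\<close> from the power difference cancels against the factorial, and
  the bounds sum to \<open>exp r - 1\<close>.\<close>

lemma norm_exp_diff_linear_le: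
  fixes A B :: "'a::{real_normed_algebra_1,banach}"
  assumes "norm A \<le> r" "norm B \<le> r"
  shows "norm (exp A - exp B - (A - B)) \<le> (exp r - 1) * norm (A - B)"
proof -
  let ?f = "\<lambda>X n. inverse (fact (n + 2)) *\<^sub>R (X ^ (n + 2) :: 'a)"
  let ?g = "\<lambda>n. inverse (fact (Suc n)) *\<^sub>R r ^ Suc n"
  have sm: "summable (?f X)" for X
    using summable_ignore_initial_segment[OF summable_exp_generic[of X], of 2]
    by (simp add: divide_inverse)
  have sg: "summable ?g"
    using summable_ignore_initial_segment[OF summable_exp_generic[of r], of 1]
    by (simp add: divide_inverse)
  have "exp A - exp B - (A - B) = (\<Sum>n. ?f A n - ?f B n)"
    unfolding exp_first_two_terms[of A] exp_first_two_terms[of B] suminf_diff[OF sm sm, symmetric]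
    by simp
  also have "norm \<dots> \<le> (\<Sum>n. ?g n * norm (A - B))"
  proof (rule norm_suminf_le)
    fix n
    have "norm (?f A n - ?f B n) = inverse (fact (n + 2)) * norm (A ^ Suc (Suc n) - B ^ Suc (Suc n))"
      by (simp add: scaleR_diff_right[symmetric])
    also have "\<dots> \<le> inverse (fact (n + 2)) * (real (Suc (Suc n)) * r ^ Suc n * norm (A - B))"
      by (intro mult_left_mono norm_power_diff_le assms) auto
    also have "\<dots> = ?g n * norm (A - B)"
    proof -
      have "(fact (n + 2) :: real) = real (Suc (Suc n)) * fact (Suc n)"
        by (simp add: mult.assoc)
      then show ?thesis by (simp del: fact_Suc of_nat_Suc)
    qed
    finally show "norm (?f A n - ?f B n) \<le> ?g n * norm (A - B)" .
  qed (intro summable_mult2 sg)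
  also have "\<dots> = (exp r - 1) * norm (A - B)"
    unfolding suminf_mult2[OF sg, symmetric] by (simp add: exp_first_term[of r])
  finally show ?thesis .
qed

text \<open>On the ball of radius 1/4 the map \<open>exp\<close> minus the identity contracts by
  1/2. Local injectivity and local surjectivity of \<open>exp\<close> both rest on this.\<close>

lemma norm_exp_diff_linear_le_half:
  fixes A B :: "'a::{real_normed_algebra_1,banach}"
  assumes "norm A \<le> 1 / 4" "norm B \<le> 1 / 4"
  shows "norm (exp A - exp B - (A - B)) \<le> norm (A - B) / 2"
proof -
  \<comment> \<open>\<open>exp_bound\<close> bounds the left side by 1/4 + 1/16.\<close>
  have "exp (1 / 4 :: real) - 1 \<le> 1 / 2"
    using exp_bound[of "1 / 4 :: real"] by (simp add: power2_eq_square)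
  then have "(exp (1 / 4) - 1) * norm (A - B) \<le> 1 / 2 * norm (A - B)"
    by (intro mult_right_mono) auto
  with norm_exp_diff_linear_le[OF assms] show ?thesis by simp
qed

text \<open>For equal exponentials the contraction estimate reads
  \<open>norm (A - B) \<le> norm (A - B) / 2\<close>.\<close>

lemma exp_locally_injective:
  fixes A B :: "'a::{real_normed_algebra_1,banach}"
  assumes "norm A \<le> 1 / 4" "norm B \<le> 1 / 4" "exp A = exp B"
  shows "A = B"
  using norm_exp_diff_linear_le_half[OF assms(1,2)] assms(3) by (simp add: norm_minus_commute)

text \<open>Factor \<open>norm A ^ 3\<close> out of the tail of the series and replace
  \<open>fact (n + 3)\<close> by the smaller \<open>fact n\<close>.\<close>

lemma norm_exp_second_order_le:
  fixes A :: "'a::{real_normed_algebra_1,banach}"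
  shows "norm (exp A - 1 - A - A\<^sup>2 /\<^sub>R 2) \<le> norm A ^ 3 * exp (norm A)"
proof -
  let ?f = "\<lambda>n. inverse (fact (n + 3)) *\<^sub>R A ^ (n + 3)"
  let ?g = "\<lambda>n. norm A ^ n /\<^sub>R fact n"
  have "exp A - 1 - A - A\<^sup>2 /\<^sub>R 2 = (\<Sum>n. ?f n)"
    unfolding exp_first_terms[of A 3] by (simp add: eval_nat_numeral)
  also have "norm \<dots> \<le> (\<Sum>n. norm A ^ 3 * ?g n)"
  proof (rule norm_suminf_le)
    fix n
    have "norm (?f n) \<le> inverse (fact (n + 3)) * norm A ^ (n + 3)"
      by (simp add: norm_power_ineq divide_right_mono field_simps)
    also have "\<dots> \<le> inverse (fact n) * norm A ^ (n + 3)"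
      by (intro mult_right_mono le_imp_inverse_le fact_mono) auto
    finally show "norm (?f n) \<le> norm A ^ 3 * ?g n"
      by (simp add: power_add field_simps)
  qed (intro summable_mult summable_exp_generic)
  also have "\<dots> = norm A ^ 3 * exp (norm A)"
    unfolding exp_def by (rule suminf_mult) (rule summable_exp_generic)
  finally show ?thesis .
qed

text \<open>The logarithm is the fixed point of \<open>L \<mapsto> L - exp L + 1 + H\<close>, which is a contraction near \<open>0\<close>.\<close>

lemma exp_locally_surjective:
  fixes H :: "'a::{real_normed_algebra_1,banach}"
  assumes S: "closed S" "subspace S" "\<And>A. A \<in> S \<Longrightarrow> exp A \<in> S"
    and H: "H \<in> S" "norm H \<le> 1 / 8"
  shows "\<exists>L\<in>S. exp L = 1 + H \<and> norm L \<le> 2 * norm H"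
proof -
  define g where "g = (\<lambda>L. L - exp L + 1 + H)"
  \<comment> \<open>Iterating inside \<open>S\<close> puts the fixed point in \<open>S\<close>; the
    instance used later is the set of self-adjoint elements.\<close>
  let ?T = "S \<inter> cball 0 (1 / 4)"
  have 1: "1 \<in> S" using S(3)[of 0] subspace_0[OF S(2)] by simp
  \<comment> \<open>This gives 1/8 + 1/8 = 1/4 for the self-map property, and at the fixed point it
    becomes \<open>norm L \<le> 2 * norm H\<close>.\<close>
  have bound: "norm (g L) \<le> norm L / 2 + norm H" if "norm L \<le> 1 / 4" for L
  proof -
    have "g L = H - (exp L - exp 0 - (L - 0))" by (simp add: g_def)
    then have "norm (g L) \<le> norm H + norm (exp L - exp 0 - (L - 0))"
      using norm_triangle_ineq4 by metis
    with norm_exp_diff_linear_le_half[of L 0] that show ?thesis by simp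
  qed
  have "\<exists>!L\<in>?T. g L = L"
  proof (rule Banach_fix)
    show "complete ?T"
      using S(1) by (simp add: complete_eq_closed closed_Int)
    show "?T \<noteq> {}" using subspace_0[OF S(2)] by auto
    show "g ` ?T \<subseteq> ?T"
    proof safe
      fix L assume L: "L \<in> S" "L \<in> cball 0 (1 / 4)"
      show "g L \<in> S" unfolding g_def
        using L S H 1 by (intro subspace_add subspace_diff) auto
      show "g L \<in> cball 0 (1 / 4)" using bound[of L] L H by simp
    qed
    fix A B assume "A \<in> ?T" "B \<in> ?T"
    moreover have "g A - g B = - (exp A - exp B - (A - B))" by (simp add: g_def)
    ultimately show "dist (g A) (g B) \<le> 1 / 2 * dist A B"
      using norm_exp_diff_linear_le_half[of A B] by (simp only: dist_norm norm_minus_cancel) simp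
  qed auto
  then obtain L where L: "L \<in> S" "norm L \<le> 1 / 4" "g L = L" by auto
  have "exp L = 1 + H" using L(3) by (simp add: g_def algebra_simps)
  moreover have "norm L \<le> 2 * norm H" using bound[of L] L by simp
  ultimately show ?thesis using L(1) by blast
qed

subsection \<open>Vector-valued Landau estimates at the origin\<close>

text \<open>The filter \<open>nhds 0\<close> includes the point 0 itself, so for
  \<open>k > 0\<close> the estimate forces \<open>f 0 = 0\<close>.\<close>

definition vbigo :: "nat \<Rightarrow> (real \<Rightarrow> 'v::real_normed_vector) \<Rightarrow> bool"
  where "vbigo k f \<longleftrightarrow> (\<lambda>t. norm (f t)) \<in> O[nhds 0](\<lambda>t. t ^ k)"

lemma vbigoI:
  assumes "\<forall>\<^sub>F t in nhds 0. norm (f t) \<le> c * \<bar>t\<bar> ^ k"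
  shows "vbigo k f"
  unfolding vbigo_def by (rule bigoI[of _ c]) (use assms in \<open>simp add: power_abs\<close>)

lemma vbigoE:
  assumes "vbigo k f"
  obtains c where "c > 0" "\<forall>\<^sub>F t in nhds 0. norm (f t) \<le> c * \<bar>t\<bar> ^ k"
  using assms unfolding vbigo_def by (elim landau_o.bigE) (simp add: power_abs)

lemma vbigo_cong:
  assumes "\<forall>\<^sub>F t in nhds 0. f t = g t" "vbigo k f"
  shows "vbigo k g"
proof -
  obtain c where "\<forall>\<^sub>F t in nhds 0. norm (f t) \<le> c * \<bar>t\<bar> ^ k"
    using assms(2) by (rule vbigoE)
  with assms(1) have "\<forall>\<^sub>F t in nhds 0. norm (g t) \<le> c * \<bar>t\<bar> ^ k"
    by eventually_elim simp
  then show ?thesis by (rule vbigoI)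
qed

lemma vbigo_add:
  assumes "vbigo k f" "vbigo k g"
  shows "vbigo k (\<lambda>t. f t + g t)"
proof -
  obtain c where c: "\<forall>\<^sub>F t in nhds 0. norm (f t) \<le> c * \<bar>t\<bar> ^ k"
    using assms(1) by (rule vbigoE)
  obtain d where d: "\<forall>\<^sub>F t in nhds 0. norm (g t) \<le> d * \<bar>t\<bar> ^ k"
    using assms(2) by (rule vbigoE)
  from c d have "\<forall>\<^sub>F t in nhds 0. norm (f t + g t) \<le> (c + d) * \<bar>t\<bar> ^ k"
    by eventually_elim (smt (verit) norm_triangle_ineq distrib_right)
  then show ?thesis by (rule vbigoI)
qed

lemma vbigo_linear:
  assumes "vbigo k f" "bounded_linear h"
  shows "vbigo k (\<lambda>t. h (f t))"
proof -
  obtain c where c: "\<forall>\<^sub>F t in nhds 0. norm (f t) \<le> c * \<bar>t\<bar> ^ k"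
    using assms(1) by (rule vbigoE)
  obtain K where K: "0 < K" "\<And>x. norm (h x) \<le> norm x * K"
    using bounded_linear.pos_bounded[OF assms(2)] by blast
  from c have "\<forall>\<^sub>F t in nhds 0. norm (h (f t)) \<le> (c * K) * \<bar>t\<bar> ^ k"
  proof eventually_elim
    case (elim t)
    have "norm (h (f t)) \<le> norm (f t) * K" by (rule K)
    also have "\<dots> \<le> c * \<bar>t\<bar> ^ k * K" using elim K by (intro mult_right_mono) auto
    finally show ?case by (simp add: ac_simps)
  qed
  then show ?thesis by (rule vbigoI)
qed

lemma vbigo_scaleR: "vbigo k f \<Longrightarrow> vbigo k (\<lambda>t. c *\<^sub>R f t)"
  by (erule vbigo_linear) (rule bounded_linear_scaleR_right)

lemma vbigo_diff:
  assumes "vbigo k f" "vbigo k g"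
  shows "vbigo k (\<lambda>t. f t - g t)"
  using vbigo_add[OF assms(1) vbigo_scaleR[OF assms(2), of "-1"]] by simp

lemma vbigo_mult:
  fixes f g :: "real \<Rightarrow> 'v::real_normed_algebra"
  assumes "vbigo j f" "vbigo k g"
  shows "vbigo (j + k) (\<lambda>t. f t * g t)"
proof -
  obtain c where c: "0 < c" "\<forall>\<^sub>F t in nhds 0. norm (f t) \<le> c * \<bar>t\<bar> ^ j"
    using assms(1) by (rule vbigoE)
  obtain d where d: "0 < d" "\<forall>\<^sub>F t in nhds 0. norm (g t) \<le> d * \<bar>t\<bar> ^ k"
    using assms(2) by (rule vbigoE)
  from c(2) d(2) have "\<forall>\<^sub>F t in nhds 0. norm (f t * g t) \<le> (c * d) * \<bar>t\<bar> ^ (j + k)"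
  proof eventually_elim
    case (elim t)
    have "norm (f t * g t) \<le> norm (f t) * norm (g t)" by (rule norm_mult_ineq)
    also have "\<dots> \<le> (c * \<bar>t\<bar> ^ j) * (d * \<bar>t\<bar> ^ k)"
      using elim c(1) by (intro mult_mono) auto
    finally show ?case by (simp add: power_add ac_simps)
  qed
  then show ?thesis by (rule vbigoI)
qed

lemma eventually_nhds_abs_le:
  fixes r :: real
  assumes "0 < r"
  shows "\<forall>\<^sub>F t in nhds 0. \<bar>t\<bar> \<le> r"
  unfolding eventually_nhds_metric using assms by (intro exI[of _ r]) (auto simp: dist_real_def)

lemma vbigo_mono:
  assumes "j \<le> k" "vbigo k f"
  shows "vbigo j f"
proof -
  obtain c where c: "0 < c" "\<forall>\<^sub>F t in nhds 0. norm (f t) \<le> c * \<bar>t\<bar> ^ k"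
    using assms(2) by (rule vbigoE)
  have "\<forall>\<^sub>F t::real in nhds 0. \<bar>t\<bar> \<le> 1" by (rule eventually_nhds_abs_le) simp
  with c(2) have "\<forall>\<^sub>F t in nhds 0. norm (f t) \<le> c * \<bar>t\<bar> ^ j"
  proof eventually_elim
    case (elim t)
    have "c * \<bar>t\<bar> ^ k \<le> c * \<bar>t\<bar> ^ j"
      using elim c(1) assms(1) by (intro mult_left_mono power_decreasing) auto
    with elim show ?case by linarith
  qed
  then show ?thesis by (rule vbigoI)
qed

lemma vbigo_monomial: "vbigo k (\<lambda>t. t ^ k *\<^sub>R A)"
  by (rule vbigoI[of _ "norm A"]) (simp add: power_abs mult.commute)

section \<open>Second-order expansions of exponential and logarithm along curves through the
  origin\<close>

lemma vbigo_exp_second_order: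
  fixes L :: "real \<Rightarrow> 'v::{real_normed_algebra_1,banach}"
  assumes "vbigo 1 L"
  shows "vbigo 3 (\<lambda>t. exp (L t) - 1 - L t - (L t)\<^sup>2 /\<^sub>R 2)"
proof -
  obtain c where c: "0 < c" "\<forall>\<^sub>F t in nhds 0. norm (L t) \<le> c * \<bar>t\<bar> ^ 1"
    using assms by (rule vbigoE)
  \<comment> \<open>In this range \<open>norm (L t) \<le> 1\<close>, so the exponential factor of
    the Taylor remainder is at most \<open>exp 1\<close>.\<close>
  have "\<forall>\<^sub>F t in nhds 0. \<bar>t\<bar> \<le> 1 / c" using c(1) by (intro eventually_nhds_abs_le) simp
  with c(2) have "\<forall>\<^sub>F t in nhds 0.
      norm (exp (L t) - 1 - L t - (L t)\<^sup>2 /\<^sub>R 2) \<le> (c ^ 3 * exp 1) * \<bar>t\<bar> ^ 3"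
  proof eventually_elim
    case (elim t)
    have "c * \<bar>t\<bar> \<le> 1" using elim(2) c(1) by (simp add: field_simps)
    then have "norm (L t) \<le> 1" using elim(1) by simp
    have "norm (exp (L t) - 1 - L t - (L t)\<^sup>2 /\<^sub>R 2) \<le> norm (L t) ^ 3 * exp (norm (L t))"
      by (rule norm_exp_second_order_le)
    also have "\<dots> \<le> (c * \<bar>t\<bar>) ^ 3 * exp 1"
      using elim(1) \<open>norm (L t) \<le> 1\<close> by (intro mult_mono power_mono) (use c(1) in auto)
    finally show ?case by (simp add: power_mult_distrib ac_simps)
  qed
  then show ?thesis by (rule vbigoI)
qed

text \<open>With \<open>W = t *\<^sub>R Z\<close>, the noncommutative identity L^2 - W^2 = L (L - W)
  + (L - W) W exhibits products of orders 1 + 2 and 2 + 1.\<close>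

lemma vbigo_square_diff:
  fixes L :: "real \<Rightarrow> 'v::real_normed_algebra_1"
  assumes "vbigo 1 L" "vbigo 2 (\<lambda>t. L t - t *\<^sub>R Z)"
  shows "vbigo 3 (\<lambda>t. (L t)\<^sup>2 - t\<^sup>2 *\<^sub>R Z\<^sup>2)"
proof -
  have "vbigo 3 (\<lambda>t. L t * (L t - t *\<^sub>R Z))"
    using vbigo_mult[OF assms] by (simp add: numeral_eq_Suc)
  moreover have "vbigo 3 (\<lambda>t. (L t - t *\<^sub>R Z) * (t *\<^sub>R Z))"
    using vbigo_mult[OF assms(2), of 1 "\<lambda>t. t *\<^sub>R Z"] vbigo_monomial[of 1 Z]
    by (simp add: numeral_eq_Suc)
  ultimately have "vbigo 3 (\<lambda>t. L t * (L t - t *\<^sub>R Z) + (L t - t *\<^sub>R Z) * (t *\<^sub>R Z))"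
    by (rule vbigo_add)
  then show ?thesis by (simp add: algebra_simps power2_eq_square)
qed

text \<open>A bootstrap: the equation for \<open>exp (L t)\<close> first yields
  \<open>L t = t *\<^sub>R X\<close> up to order 2. Hence the square of \<open>L t\<close> is known
  up to order 3, and feeding it back into the same equation improves the expansion of
  \<open>L t\<close>.\<close>

lemma vbigo_log_second_order:
  fixes L :: "real \<Rightarrow> 'v::{real_normed_algebra_1,banach}"
  assumes L: "vbigo 1 L" and "\<forall>\<^sub>F t in nhds 0. exp (L t) = 1 + t *\<^sub>R X"
  shows "vbigo 3 (\<lambda>t. L t - (t *\<^sub>R X - t\<^sup>2 *\<^sub>R X\<^sup>2 /\<^sub>R 2))"
proof -
  let ?R = "\<lambda>t. exp (L t) - 1 - L t - (L t)\<^sup>2 /\<^sub>R 2"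
  have R: "vbigo 3 ?R" by (rule vbigo_exp_second_order[OF L])
  have "vbigo 2 (\<lambda>t. (L t)\<^sup>2 /\<^sub>R 2)"
    using vbigo_mult[OF L L] by (intro vbigo_scaleR) (simp add: numeral_eq_Suc)
  then have "vbigo 2 (\<lambda>t. - 1 *\<^sub>R ?R t - (L t)\<^sup>2 /\<^sub>R 2)"
    by (intro vbigo_diff[OF vbigo_scaleR[OF vbigo_mono[OF _ R]]]) simp_all
  then have "vbigo 2 (\<lambda>t. L t - t *\<^sub>R X)"
    by (rule vbigo_cong[rotated])
      (use assms(2) in \<open>eventually_elim, simp add: algebra_simps\<close>)
  from vbigo_square_diff[OF L this]
  have "vbigo 3 (\<lambda>t. - 1 *\<^sub>R ?R t - ((L t)\<^sup>2 - t\<^sup>2 *\<^sub>R X\<^sup>2) /\<^sub>R 2)"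
    by (rule vbigo_diff[OF vbigo_scaleR[OF R] vbigo_scaleR])
  then show ?thesis
    by (rule vbigo_cong[rotated])
      (use assms(2) in \<open>eventually_elim, simp add: algebra_simps\<close>)
qed

lemma vbigo_exp_log_add_log:
  fixes X Y :: "'v::{real_normed_algebra_1,banach}"
  assumes "vbigo 1 L" "\<forall>\<^sub>F t in nhds 0. exp (L t) = 1 + t *\<^sub>R X"
    and "vbigo 1 M" "\<forall>\<^sub>F t in nhds 0. exp (M t) = 1 + t *\<^sub>R Y"
  shows "vbigo 3 (\<lambda>t. exp (L t + M t) - (1 + t *\<^sub>R (X + Y) + t\<^sup>2 *\<^sub>R (X * Y + Y * X) /\<^sub>R 2))"
proof -
  define Z where "Z = X + Y"
  define S where "S t = L t + M t" for t
  let ?Q = "\<lambda>t. t\<^sup>2 *\<^sub>R (X\<^sup>2 + Y\<^sup>2) /\<^sub>R 2"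
  have S: "vbigo 1 S" unfolding S_def by (intro vbigo_add assms)
  have S3: "vbigo 3 (\<lambda>t. S t - t *\<^sub>R Z + ?Q t)"
    using vbigo_add[OF vbigo_log_second_order[OF assms(1,2)] vbigo_log_second_order[OF assms(3,4)]]
    by (simp add: S_def Z_def algebra_simps)
  \<comment> \<open>The quadratic part \<open>?Q\<close> is itself of order 2, so dropping it gives
    the hypothesis of \<open>vbigo_square_diff\<close>.\<close>
  have "vbigo 2 (\<lambda>t. (S t - t *\<^sub>R Z + ?Q t) - t\<^sup>2 *\<^sub>R ((X\<^sup>2 + Y\<^sup>2) /\<^sub>R 2))"
    by (intro vbigo_diff vbigo_mono[OF _ S3] vbigo_monomial) simp
  then have "vbigo 2 (\<lambda>t. S t - t *\<^sub>R Z)" by (simp add: mult.commute)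
  from vbigo_square_diff[OF S this]
  \<comment> \<open>Three remainders are added: that of the exponential, that of the two logarithms
    and that of the square. What survives at order 2 is Z^2 - X^2 - Y^2 = XY + YX, halved.\<close>
  have "vbigo 3 (\<lambda>t. (exp (S t) - 1 - S t - (S t)\<^sup>2 /\<^sub>R 2) + (S t - t *\<^sub>R Z + ?Q t)
      + ((S t)\<^sup>2 - t\<^sup>2 *\<^sub>R Z\<^sup>2) /\<^sub>R 2)"
    by (intro vbigo_add vbigo_scaleR vbigo_exp_second_order S S3)
  moreover have "(exp (S t) - 1 - S t - (S t)\<^sup>2 /\<^sub>R 2) + (S t - t *\<^sub>R Z + ?Q t)
      + ((S t)\<^sup>2 - t\<^sup>2 *\<^sub>R Z\<^sup>2) /\<^sub>R 2
      = exp (S t) - (1 + t *\<^sub>R Z + t\<^sup>2 *\<^sub>R (X * Y + Y * X) /\<^sub>R 2)" for t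
    by (simp add: Z_def power2_eq_square algebra_simps)
  ultimately show ?thesis by (simp only: S_def Z_def)
qed

subsection \<open>Matrices as a Banach algebra\<close>

lemma bounded_linear_mv: "bounded_linear ((*v) (A :: 'n::finite cmat))"
  by (rule matrix_vector_mul_bounded_linear)

lemma scaleR_matrix_vector: "(r *\<^sub>R A) *v x = r *\<^sub>R ((A :: 'n::finite cmat) *v x)"
  by (simp add: matrix_vector_mult_def vec_eq_iff scaleR_sum_right)

lemma scaleR_matrix_mult:
  fixes A B :: "'n::finite cmat"
  shows "(r *\<^sub>R A) ** B = r *\<^sub>R (A ** B)" "A ** (r *\<^sub>R B) = r *\<^sub>R (A ** B)"
  by (simp_all add: matrix_matrix_mult_def vec_eq_iff scaleR_sum_right)

lemma matrix_add_rdistrib: "(A + B) ** C = A ** C + (B :: 'n::finite cmat) ** C"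
  by (simp add: matrix_matrix_mult_def vec_eq_iff sum.distrib distrib_right)

lemma onorm_mv_eq_0: "onorm ((*v) (A :: 'n::finite cmat)) = 0 \<longleftrightarrow> A = 0"
  unfolding onorm_eq_0[OF bounded_linear_mv] matrix_eq by simp

lemma onorm_mv_add_le: "onorm ((*v) (A + B)) \<le> onorm ((*v) A) + onorm ((*v) (B :: 'n::finite cmat))"
proof -
  have "(*v) (A + B) = (\<lambda>x. A *v x + B *v x)"
    by (simp add: fun_eq_iff matrix_vector_mult_add_rdistrib)
  then show ?thesis by (simp only: onorm_triangle[OF bounded_linear_mv bounded_linear_mv])
qed

lemma onorm_mv_scaleR: "onorm ((*v) (r *\<^sub>R A)) = \<bar>r\<bar> * onorm ((*v) (A :: 'n::finite cmat))"
proof -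
  have "(*v) (r *\<^sub>R A) = (\<lambda>x. r *\<^sub>R (A *v x))"
    by (simp add: fun_eq_iff scaleR_matrix_vector)
  then show ?thesis by (simp only: onorm_scaleR[OF bounded_linear_mv])
qed

lemma onorm_mv_one: "onorm ((*v) (mat 1 :: 'n::finite cmat)) = 1"
proof -
  have "(*v) (mat 1) = (\<lambda>x :: complex ^ 'n. x)" by (simp add: fun_eq_iff)
  then show ?thesis by (simp only: onorm_id)
qed

text \<open>The copy \<open>matalg\<close> of the matrix type carries the operator norm and the matrix product, so that
  the library's \<^const>\<open>exp\<close> applies to it; on the matrix type itself, \<open>*\<close> is the entrywise product.\<close>

typedef 'n matalg = "UNIV :: 'n::finite cmat set"
  morphisms mat_of Alg by simp

setup_lifting type_definition_matalg

instantiation matalg :: (finite) real_normed_algebra_1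
begin

lift_definition zero_matalg :: "'a matalg" is 0 .
lift_definition one_matalg :: "'a matalg" is "mat 1" .
lift_definition plus_matalg :: "'a matalg \<Rightarrow> 'a matalg \<Rightarrow> 'a matalg" is "(+)" .
lift_definition minus_matalg :: "'a matalg \<Rightarrow> 'a matalg \<Rightarrow> 'a matalg" is "(-)" .
lift_definition uminus_matalg :: "'a matalg \<Rightarrow> 'a matalg" is uminus .
lift_definition times_matalg :: "'a matalg \<Rightarrow> 'a matalg \<Rightarrow> 'a matalg" is "(**)" .
lift_definition scaleR_matalg :: "real \<Rightarrow> 'a matalg \<Rightarrow> 'a matalg" is scaleR .
lift_definition norm_matalg :: "'a matalg \<Rightarrow> real" is "\<lambda>A. onorm ((*v) A)" .

definition dist_matalg :: "'a matalg \<Rightarrow> 'a matalg \<Rightarrow> real"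
  where "dist_matalg A B = norm (A - B)"

definition sgn_matalg :: "'a matalg \<Rightarrow> 'a matalg"
  where "sgn_matalg A = inverse (norm A) *\<^sub>R A"

definition uniformity_matalg :: "('a matalg \<times> 'a matalg) filter"
  where "uniformity_matalg = (INF e\<in>{0 <..}. principal {(x, y). dist x y < e})"

definition open_matalg :: "'a matalg set \<Rightarrow> bool"
  where "open_matalg S = (\<forall>x\<in>S. \<forall>\<^sub>F (x', y) in uniformity. x' = x \<longrightarrow> y \<in> S)"

instance
proof
  fix A B C :: "'a matalg" and r s :: real and S :: "'a matalg set"
  show "dist A B = norm (A - B)" by (rule dist_matalg_def)
  show "sgn A = inverse (norm A) *\<^sub>R A" by (rule sgn_matalg_def)
  show "uniformity = (INF e\<in>{0 <..}. principal {(x, y). dist (x :: 'a matalg) y < e})"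
    by (rule uniformity_matalg_def)
  show "open S \<longleftrightarrow> (\<forall>x\<in>S. \<forall>\<^sub>F (x', y) in uniformity. x' = x \<longrightarrow> y \<in> S)"
    by (rule open_matalg_def)
  show "A + B + C = A + (B + C)" "A + B = B + A" "0 + A = A" "- A + A = 0" "A - B = A + - B"
    by (transfer, simp add: algebra_simps)+
  show "r *\<^sub>R (A + B) = r *\<^sub>R A + r *\<^sub>R B" "(r + s) *\<^sub>R A = r *\<^sub>R A + s *\<^sub>R A"
    "r *\<^sub>R s *\<^sub>R A = (r * s) *\<^sub>R A" "1 *\<^sub>R A = A"
    by (transfer, simp add: algebra_simps)+
  show "A * B * C = A * (B * C)" by transfer (simp add: matrix_mul_assoc)
  show "(A + B) * C = A * C + B * C" "A * (B + C) = A * B + A * C"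
    by (transfer, simp add: matrix_add_rdistrib matrix_add_ldistrib)+
  show "r *\<^sub>R A * B = r *\<^sub>R (A * B)" "A * r *\<^sub>R B = r *\<^sub>R (A * B)"
    by (transfer, simp add: scaleR_matrix_mult)+
  show "1 * A = A" "A * 1 = A" by (transfer, simp)+
  show "(0 :: 'a matalg) \<noteq> 1" by transfer (simp add: vec_eq_iff mat_def)
  show "norm A = 0 \<longleftrightarrow> A = 0" by transfer (rule onorm_mv_eq_0)
  show "norm (A + B) \<le> norm A + norm B"
    by transfer (rule onorm_mv_add_le)
  show "norm (r *\<^sub>R A) = \<bar>r\<bar> * norm A"
    by transfer (rule onorm_mv_scaleR)
  show "norm (A * B) \<le> norm A * norm B"
    by transfer (use onorm_compose[OF bounded_linear_mv bounded_linear_mv] in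
        \<open>simp add: o_def matrix_vector_mul_assoc\<close>)
  show "norm (1 :: 'a matalg) = 1" by transfer (rule onorm_mv_one)
qed

end

section \<open>Equivalence of the operator norm with the Euclidean norm, and completeness\<close>

lemma bounded_linear_Alg: "bounded_linear Alg"
  unfolding linear_conv_bounded_linear[symmetric]
  by (rule linearI) (transfer, simp)+

text \<open>The entry is a coordinate of the image of a unit basis vector.\<close>

lemma norm_entry_le_onorm:
  fixes A :: "'n::finite cmat"
  shows "norm (A $ i $ j) \<le> onorm ((*v) A)"
proof -
  have "A $ i $ j = (A *v axis j 1) $ i"
    by (simp add: matrix_vector_mult_def axis_def if_distrib cong: if_cong)
  also have "norm \<dots> \<le> norm (A *v axis j 1)" by (rule Finite_Cartesian_Product.norm_nth_le)
  also have "\<dots> \<le> onorm ((*v) A) * norm (axis j (1 :: complex) :: complex ^ 'n)"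
    by (rule onorm[OF bounded_linear_mv])
  finally show ?thesis by simp
qed

lemma bounded_linear_mat_of: "bounded_linear mat_of"
proof (rule bounded_linear_intro)
  show "mat_of (A + B) = mat_of A + mat_of B" "mat_of (r *\<^sub>R A) = r *\<^sub>R mat_of A"
    for A B :: "'a matalg" and r by (transfer, simp)+
  fix A :: "'a matalg"
  have "norm (mat_of A) \<le> (\<Sum>i\<in>UNIV. norm (mat_of A $ i))"
    by (simp add: norm_vec_def L2_set_le_sum)
  also have "\<dots> \<le> (\<Sum>i\<in>UNIV. \<Sum>j\<in>UNIV. norm (mat_of A $ i $ j))"
    by (intro sum_mono) (simp add: norm_vec_def L2_set_le_sum)
  also have "\<dots> \<le> (\<Sum>i\<in>(UNIV :: 'a set). \<Sum>j\<in>(UNIV :: 'a set). norm A)"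
    by (intro sum_mono) (simp add: norm_matalg.rep_eq norm_entry_le_onorm)
  also have "\<dots> = norm A * (real CARD('a))\<^sup>2"
    by (simp add: power2_eq_square)
  finally show "norm (mat_of A) \<le> norm A * (real CARD('a))\<^sup>2" .
qed

instance matalg :: (finite) banach
proof
  fix X :: "nat \<Rightarrow> 'a matalg" assume "Cauchy X"
  \<comment> \<open>Completeness is inherited from the matrix type: \<open>mat_of\<close> preserves
    Cauchy sequences and \<open>Alg\<close> carries the limit back.\<close>
  then have "Cauchy (\<lambda>n. mat_of (X n))"
    by (rule bounded_linear.Cauchy[OF bounded_linear_mat_of])
  then obtain L where "(\<lambda>n. mat_of (X n)) \<longlonglongrightarrow> L"
    using Cauchy_convergent convergent_def by blast
  from bounded_linear.tendsto[OF bounded_linear_Alg this]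
  show "convergent X" by (auto simp: mat_of_inverse convergent_def)
qed

lemma mat_of_power: "mat_of (A ^ k) = mpow (mat_of A) k"
  by (induction k) (simp_all add: mpow_def one_matalg.rep_eq times_matalg.rep_eq)

text \<open>Continuity and linearity of \<open>mat_of\<close> let it pass through the series, so
  results on \<open>exp\<close> become results on \<open>mexp\<close>.\<close>

lemma mat_of_exp: "mat_of (exp A) = mexp (mat_of A)"
  using bounded_linear.suminf[OF bounded_linear_mat_of summable_exp_generic[of A]]
  by (simp add: exp_def mexp_def scaleR_matalg.rep_eq mat_of_power)

subsection \<open>Adjoints and the uniqueness of Hermitian logarithms\<close>

lemma adj_mult: "adj (A ** B) = adj B ** adj A"
  by (simp add: adj_def matrix_matrix_mult_def vec_eq_iff mult.commute)

lemma adj_one: "adj (mat 1) = mat 1"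
  by (auto simp: adj_def mat_def vec_eq_iff)

lemma linear_adj: "linear adj"
  by (rule linearI) (simp_all add: adj_def vec_eq_iff)

text \<open>The involution of the matrix algebra, not to be confused with the product
  \<open>star_prod\<close>.\<close>

lift_definition star :: "'n::finite matalg \<Rightarrow> 'n matalg" is adj .

lemma star_mult: "star (A * B) = star B * star A"
  by transfer (rule adj_mult)

lemma star_one: "star 1 = 1"
  by transfer (rule adj_one)

lemma star_scaleR: "star (r *\<^sub>R A) = r *\<^sub>R star A"
  by transfer (rule linear_cmul[OF linear_adj])

lemma star_diff: "star (A - B) = star A - star B"
  by transfer (rule linear_diff[OF linear_adj])

lemma star_power: "star (A ^ k) = star A ^ k"
proof (induction k)
  case 0
  show ?case by (simp add: star_one)
next
  case (Suc k)
  then show ?case by (simp add: star_mult power_commutes)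
qed

text \<open>Continuity of the involution lets it pass through the exponential series and makes the
  set of self-adjoint elements closed.\<close>

lemma bounded_linear_star: "bounded_linear (star :: 'n::finite matalg \<Rightarrow> 'n matalg)"
proof -
  have "star = (\<lambda>A :: 'n matalg. Alg (adj (mat_of A)))"
    by (simp add: fun_eq_iff star_def)
  moreover have "bounded_linear (\<lambda>A :: 'n matalg. Alg (adj (mat_of A)))"
    using linear_adj unfolding linear_conv_bounded_linear
    by (intro bounded_linear_compose[OF bounded_linear_Alg]
        bounded_linear_compose[OF _ bounded_linear_mat_of])
  ultimately show ?thesis by simp
qed

lemma star_exp: "star (exp A) = exp (star A)"
  using bounded_linear.suminf[OF bounded_linear_star summable_exp_generic[of A]]
  by (simp add: exp_def star_power star_scaleR)

lemma hermitian_iff_star: "hermitian (mat_of A) \<longleftrightarrow> star A = A"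
  unfolding hermitian_def by transfer rule

text \<open>The norm of the nested vector type is the Frobenius norm.\<close>

lemma Re_trace_adj_mult: "Re (trace (adj M ** M)) = (norm M)\<^sup>2"
proof -
  have "Re (trace (adj M ** M)) = (\<Sum>i\<in>UNIV. \<Sum>k\<in>UNIV. (norm (M $ k $ i))\<^sup>2)"
    by (simp add: trace_def matrix_matrix_mult_def adj_def cmod_power2 flip: power2_eq_square)
  also have "\<dots> = (\<Sum>k\<in>UNIV. \<Sum>i\<in>UNIV. (norm (M $ k $ i))\<^sup>2)" by (rule sum.swap)
  also have "\<dots> = (norm M)\<^sup>2"
    by (simp add: norm_vec_def L2_set_def sum_nonneg)
  finally show ?thesis .
qed

lemma exp_half_square:
  fixes A :: "'a::{real_normed_algebra_1,banach}"
  shows "exp (A /\<^sub>R 2) * exp (A /\<^sub>R 2) = exp A"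
  by (simp add: exp_add_commuting[symmetric] scaleR_left_distrib[symmetric])

text \<open>With \<open>P = exp (A/2)\<close>, \<open>Q = exp (B/2)\<close>, \<open>D = P - Q\<close>, the identity \<open>P D + D Q = P\<^sup>2 - Q\<^sup>2 = 0\<close>
  gives \<open>tr (D P D) + tr (D Q D) = 0\<close>, a sum of two squared norms.\<close>

lemma exp_half_eq_if_exp_eq:
  fixes A B :: "'n::finite matalg"
  assumes A: "star A = A" and B: "star B = B" and eq: "exp A = exp B"
  shows "exp (A /\<^sub>R 2) = exp (B /\<^sub>R 2)"
proof -
  define P where "P = exp (A /\<^sub>R 2)"
  define Q where "Q = exp (B /\<^sub>R 2)"
  define D where "D = P - Q"
  define E where "E = exp (A /\<^sub>R 2 /\<^sub>R 2)"
  define F where "F = exp (B /\<^sub>R 2 /\<^sub>R 2)"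
  have stars: "star D = D" "star E = E" "star F = F"
    by (simp_all add: D_def P_def Q_def E_def F_def star_diff star_exp star_scaleR A B)
  have sq: "P = E * E" "Q = F * F"
    by (simp_all only: P_def Q_def E_def F_def exp_half_square)
  \<comment> \<open>Applied to \<open>E\<close> and \<open>F\<close>, the self-adjoint square roots
    of \<open>P\<close> and \<open>Q\<close>.\<close>
  have pos: "Re (trace (mat_of (D * (G * G) * D))) = (norm (mat_of (G * D)))\<^sup>2"
    if "star G = G" for G
  proof -
    have "D * (G * G) * D = star (G * D) * (G * D)"
      using that stars(1) by (simp add: star_mult mult.assoc)
    then show ?thesis
      by (simp add: times_matalg.rep_eq star.rep_eq Re_trace_adj_mult)
  qed
  have "P * D + D * Q = P * P - Q * Q" by (simp add: D_def algebra_simps)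
  also have "\<dots> = 0" unfolding P_def Q_def exp_half_square using eq by simp
  finally have "D * P * D + D * (D * Q) = 0"
    by (metis distrib_left mult.assoc mult_zero_right)
  then have "trace (mat_of (D * P * D)) + trace (mat_of (D * (D * Q))) = 0"
    by (metis plus_matalg.rep_eq trace_add zero_matalg.rep_eq trace_0 mat_0)
  \<comment> \<open>Cyclicity of the trace brings the second summand into the symmetric form covered
    by \<open>pos\<close>.\<close>
  moreover have "trace (mat_of (D * (D * Q))) = trace (mat_of (D * Q * D))"
    using trace_mul_sym[of "mat_of D" "mat_of (D * Q)"] by (simp add: times_matalg.rep_eq)
  ultimately have "(norm (mat_of (E * D)))\<^sup>2 + (norm (mat_of (F * D)))\<^sup>2 = 0"
    using pos[OF stars(2)] pos[OF stars(3)] sq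
    by (metis plus_complex.sel(1) zero_complex.sel(1))
  then have "mat_of (E * D) = 0" by (simp add: sum_power2_eq_zero_iff)
  then have "E * D = 0" by (metis mat_of_inject zero_matalg.rep_eq)
  \<comment> \<open>\<open>E\<close> is an exponential, hence invertible, and can be
    cancelled.\<close>
  then have "exp (- (A /\<^sub>R 2 /\<^sub>R 2)) * (E * D) = 0" by simp
  then have "D = 0"
    using exp_minus_inverse[of "- (A /\<^sub>R 2 /\<^sub>R 2)"] by (simp add: E_def mult.assoc[symmetric])
  then show ?thesis by (simp add: D_def P_def Q_def)
qed

text \<open>Repeated halving preserves equality of the exponentials and eventually brings both
  arguments into the ball of radius 1/4, where \<open>exp\<close> is injective.\<close>

lemma exp_inj_self_adjoint:
  fixes A B :: "'n::finite matalg"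
  assumes "star A = A" "star B = B" "exp A = exp B"
  shows "A = B"
proof -
  have eq: "exp ((1 / 2) ^ n *\<^sub>R A) = exp ((1 / 2) ^ n *\<^sub>R B)" for n
  proof (induction n)
    case 0
    then show ?case using assms by simp
  next
    case (Suc n)
    from exp_half_eq_if_exp_eq[OF _ _ Suc] show ?case by (simp add: star_scaleR assms)
  qed
  have ev: "\<forall>\<^sub>F n in sequentially. norm ((1 / 2) ^ n *\<^sub>R Z) < 1 / 4" for Z :: "'n matalg"
  proof (rule order_tendstoD(2))
    have "(\<lambda>n. norm ((1 / 2 :: real) ^ n *\<^sub>R Z)) \<longlonglongrightarrow> norm ((0 :: real) *\<^sub>R Z)"
      by (intro tendsto_intros LIMSEQ_realpow_zero) simp_all
    then show "(\<lambda>n. norm ((1 / 2) ^ n *\<^sub>R Z)) \<longlonglongrightarrow> 0" by simp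
  qed simp
  obtain n where "norm ((1 / 2) ^ n *\<^sub>R A) < 1 / 4" "norm ((1 / 2) ^ n *\<^sub>R B) < 1 / 4"
    using eventually_happens'[OF sequentially_bot eventually_conj[OF ev ev]] by blast
  then have "(1 / 2) ^ n *\<^sub>R A = (1 / 2) ^ n *\<^sub>R B"
    by (intro exp_locally_injective[OF _ _ eq]) simp_all
  then show ?thesis by simp
qed

text \<open>Injectivity of \<open>exp\<close> on self-adjoint elements gives the uniqueness that the
  definite description in \<open>mlog\<close> requires.\<close>

lemma mlog_mexp:
  assumes "hermitian H"
  shows "mlog (mexp H) = H"
  unfolding mlog_def
proof (rule the_equality)
  fix K assume K: "hermitian K \<and> mexp K = mexp H"
  have "mat_of (exp (Alg K)) = mat_of (exp (Alg H))"
    using K by (simp add: mat_of_exp Alg_inverse)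
  then have "exp (Alg K) = exp (Alg H)" by (simp add: mat_of_inject)
  moreover have "star (Alg K) = Alg K" "star (Alg H) = Alg H"
    using K assms hermitian_iff_star[of "Alg K"] hermitian_iff_star[of "Alg H"]
    by (simp_all add: Alg_inverse)
  ultimately have "Alg K = Alg H" by (metis exp_inj_self_adjoint)
  then show "K = H" by (simp add: Alg_inject)
qed (use assms in simp)

text \<open>The exponential is the square of \<open>E = exp (A /\<^sub>R 2)\<close>, which is
  self-adjoint and invertible, so its quadratic form at \<open>v\<close> is the squared length of
  the nonzero vector \<open>E *v v\<close>.\<close>

lemma pos_def_exp:
  assumes "star A = A"
  shows "pos_def (mat_of (exp A))"
  unfolding pos_def_def
proof safe
  show "hermitian (mat_of (exp A))"
    using assms by (simp add: hermitian_iff_star star_exp)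
  define E where "E = mat_of (exp (A /\<^sub>R 2))"
  have "adj E = E"
    using assms by (simp add: E_def hermitian_def[symmetric] hermitian_iff_star star_exp star_scaleR)
  have EE: "mat_of (exp A) = E ** E"
    by (simp only: E_def times_matalg.rep_eq[symmetric] exp_half_square)
  fix v :: "complex ^ 'a" assume "v \<noteq> 0"
  have "mat_of (exp (- (A /\<^sub>R 2))) ** E = mat 1"
    using exp_minus_inverse[of "- (A /\<^sub>R 2)"]
    by (simp add: E_def times_matalg.rep_eq[symmetric] one_matalg.rep_eq[symmetric])
  then have "mat_of (exp (- (A /\<^sub>R 2))) *v (E *v v) = v"
    by (simp add: matrix_vector_mul_assoc)
  then have "E *v v \<noteq> 0" using \<open>v \<noteq> 0\<close> by auto
  have "cscalar v (adj E *v w) = cscalar (E *v v) w" for w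
    unfolding cscalar_def matrix_vector_mult_def adj_def
    by (simp add: sum_distrib_left sum_distrib_right mult_ac) (rule sum.swap)
  then have "Re (cscalar v (mat_of (exp A) *v v)) = Re (cscalar (E *v v) (E *v v))"
    using \<open>adj E = E\<close> by (metis EE matrix_vector_mul_assoc)
  also have "\<dots> = (E *v v) \<bullet> (E *v v)"
    by (simp add: cscalar_def inner_vec_def inner_complex_def)
  finally show "0 < Re (cscalar v (mat_of (exp A) *v v))"
    using \<open>E *v v \<noteq> 0\<close> by simp
qed

subsection \<open>Second-order expansion of the star product\<close>

text \<open>Scalars are central, so adding \<open>ln d\<close> to a logarithm multiplies the
  exponential by \<open>d\<close>. This is the source of the homogeneity of the star
  product.\<close>

lemma exp_scaled:
  fixes A :: "'a::{real_normed_algebra_1,banach}"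
  assumes "0 < d"
  shows "exp (of_real (ln d) + A) = d *\<^sub>R exp A"
proof -
  have "exp (of_real (ln d) + A) = exp (of_real (ln d)) * exp A"
    by (intro exp_add_commuting) (simp add: of_real_def)
  also have "exp (of_real (ln d)) = (of_real d :: 'a)"
    using assms by (simp add: exp_of_real)
  finally show ?thesis by (simp add: of_real_def)
qed

lemma star_prod_exp:
  assumes "star L = L" "star M = M"
  shows "mat_of (exp L) \<star> mat_of (exp M) = mat_of (exp (L + M))"
  unfolding star_prod_def mat_of_exp
  using assms by (simp add: mlog_mexp hermitian_iff_star plus_matalg.rep_eq)

text \<open>The curve \<open>L\<close> is chosen pointwise by \<open>exp_locally_surjective\<close>
  on the closed subspace of self-adjoint elements; the norm bound there gives order 1.\<close>

lemma self_adjoint_log_exists: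
  fixes X :: "'n::finite matalg"
  assumes "star X = X"
  obtains L where "vbigo 1 L"
    "\<forall>\<^sub>F t in nhds 0. star (L t) = L t \<and> exp (L t) = 1 + t *\<^sub>R X"
proof -
  let ?S = "{A :: 'n matalg. star A = A}"
  have S: "closed ?S" "subspace ?S"
    by (intro closed_Collect_eq bounded_linear.continuous_on[OF bounded_linear_star] continuous_intros)
      (auto simp: subspace_def star_scaleR linear_0 linear_add bounded_linear.linear[OF bounded_linear_star])
  \<comment> \<open>The smallness condition sits under the quantifier so that choice yields a
    function defined for all \<open>t\<close>.\<close>
  have "\<exists>L. norm (t *\<^sub>R X) \<le> 1 / 8 \<longrightarrow>
      star L = L \<and> exp L = 1 + t *\<^sub>R X \<and> norm L \<le> 2 * norm (t *\<^sub>R X)" for t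
    using exp_locally_surjective[OF S, of "t *\<^sub>R X"] assms
    by (auto simp: star_exp star_scaleR)
  then obtain L where L: "\<And>t. norm (t *\<^sub>R X) \<le> 1 / 8 \<Longrightarrow>
      star (L t) = L t \<and> exp (L t) = 1 + t *\<^sub>R X \<and> norm (L t) \<le> 2 * norm (t *\<^sub>R X)"
    by metis
  \<comment> \<open>The summand 1 keeps the denominator positive when \<open>X = 0\<close>.\<close>
  have "\<forall>\<^sub>F t in nhds 0. \<bar>t\<bar> \<le> 1 / (8 * (norm X + 1))"
    by (intro eventually_nhds_abs_le) (simp add: add_nonneg_pos)
  then have small: "\<forall>\<^sub>F t in nhds 0. norm (t *\<^sub>R X) \<le> 1 / 8"
  proof eventually_elim
    case (elim t)
    have "\<bar>t\<bar> * norm X \<le> 1 / (8 * (norm X + 1)) * (norm X + 1)"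
      using elim by (intro mult_mono) simp_all
    also have "\<dots> = 1 / 8" by (simp add: add_nonneg_eq_0_iff)
    finally show ?case by simp
  qed
  have "\<forall>\<^sub>F t in nhds 0. norm (L t) \<le> (2 * norm X) * \<bar>t\<bar> ^ 1"
    using small by eventually_elim (use L in \<open>auto simp: mult_ac\<close>)
  moreover have "\<forall>\<^sub>F t in nhds 0. star (L t) = L t \<and> exp (L t) = 1 + t *\<^sub>R X"
    using small by eventually_elim (use L in auto)
  ultimately show thesis using that vbigoI by blast
qed

lemma self_adjoint_Alg: "hermitian X \<Longrightarrow> star (Alg X) = Alg X"
  using hermitian_iff_star[of "Alg X"] by (simp add: Alg_inverse)

lemma mat_of_one_plus: "mat_of (1 + t *\<^sub>R Alg X) = mat 1 + t *\<^sub>R X"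
  by (simp add: plus_matalg.rep_eq one_matalg.rep_eq scaleR_matalg.rep_eq Alg_inverse)

lemma eventually_pos_def:
  assumes "hermitian X"
  shows "\<forall>\<^sub>F t in nhds (0::real). pos_def (mat 1 + t *\<^sub>R X)"
proof -
  obtain L where "\<forall>\<^sub>F t in nhds 0. star (L t) = L t \<and> exp (L t) = 1 + t *\<^sub>R Alg X"
    using self_adjoint_log_exists[OF self_adjoint_Alg[OF assms]] by blast
  then show ?thesis
    by eventually_elim (metis pos_def_exp mat_of_one_plus)
qed

text \<open>The factor \<open>d\<close> is there for the partial trace of the identity, which is a
  multiple of the identity; the product before tracing uses \<open>d = 1\<close>.\<close>

lemma star_prod_expansion:
  fixes X Y :: "'n::finite cmat"
  assumes "hermitian X" "hermitian Y" "0 < d"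
  shows "vbigo 3 (\<lambda>t. (mat 1 + t *\<^sub>R X) \<star> (d *\<^sub>R (mat 1 + t *\<^sub>R Y))
    - d *\<^sub>R (mat 1 + t *\<^sub>R (X + Y) + t\<^sup>2 *\<^sub>R (X ** Y + Y ** X) /\<^sub>R 2))"
proof -
  obtain L where L: "vbigo 1 L"
    "\<forall>\<^sub>F t in nhds 0. star (L t) = L t \<and> exp (L t) = 1 + t *\<^sub>R Alg X"
    using self_adjoint_log_exists[OF self_adjoint_Alg[OF assms(1)]] by blast
  obtain M where M: "vbigo 1 M"
    "\<forall>\<^sub>F t in nhds 0. star (M t) = M t \<and> exp (M t) = 1 + t *\<^sub>R Alg Y"
    using self_adjoint_log_exists[OF self_adjoint_Alg[OF assms(2)]] by blast
  have "vbigo 3 (\<lambda>t. exp (L t + M t) - (1 + t *\<^sub>R (Alg X + Alg Y)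
      + t\<^sup>2 *\<^sub>R (Alg X * Alg Y + Alg Y * Alg X) /\<^sub>R 2))"
    using L M by (intro vbigo_exp_log_add_log) (auto elim: eventually_mono)
  from vbigo_scaleR[OF vbigo_linear[OF this bounded_linear_mat_of], of d]
  have "vbigo 3 (\<lambda>t. d *\<^sub>R mat_of (exp (L t + M t))
      - d *\<^sub>R (mat 1 + t *\<^sub>R (X + Y) + t\<^sup>2 *\<^sub>R (X ** Y + Y ** X) /\<^sub>R 2))"
    by (simp add: plus_matalg.rep_eq one_matalg.rep_eq scaleR_matalg.rep_eq minus_matalg.rep_eq
        times_matalg.rep_eq Alg_inverse scaleR_diff_right)
  moreover have "\<forall>\<^sub>F t in nhds 0.
      d *\<^sub>R mat_of (exp (L t + M t)) = (mat 1 + t *\<^sub>R X) \<star> (d *\<^sub>R (mat 1 + t *\<^sub>R Y))"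
    using L(2) M(2)
  proof eventually_elim
    case (elim t)
    \<comment> \<open>This element is the self-adjoint logarithm of the scaled second
      factor.\<close>
    have "star (of_real (ln d) + M t) = of_real (ln d) + M t"
      using elim by (simp add: of_real_def star_scaleR star_one
          linear_add[OF bounded_linear.linear[OF bounded_linear_star]])
    from star_prod_exp[OF conjunct1[OF elim(1)] this]
    have "mat_of (exp (L t)) \<star> (d *\<^sub>R mat_of (exp (M t)))
        = mat_of (exp (of_real (ln d) + (L t + M t)))"
      by (simp add: exp_scaled[OF assms(3)] scaleR_matalg.rep_eq add.left_commute)
    then show ?case
      using elim by (simp add: exp_scaled[OF assms(3)] scaleR_matalg.rep_eq mat_of_one_plus)
  qed
  then have "\<forall>\<^sub>F t in nhds 0.
      d *\<^sub>R mat_of (exp (L t + M t))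
        - d *\<^sub>R (mat 1 + t *\<^sub>R (X + Y) + t\<^sup>2 *\<^sub>R (X ** Y + Y ** X) /\<^sub>R 2)
      = (mat 1 + t *\<^sub>R X) \<star> (d *\<^sub>R (mat 1 + t *\<^sub>R Y))
        - d *\<^sub>R (mat 1 + t *\<^sub>R (X + Y) + t\<^sup>2 *\<^sub>R (X ** Y + Y ** X) /\<^sub>R 2)"
    by eventually_elim simp
  ultimately show ?thesis by (rule vbigo_cong[rotated])
qed

subsection \<open>The partial trace\<close>

lemma linear_ptrace_B: "linear ptrace_B"
  by (rule linearI) (simp_all add: ptrace_B_def vec_eq_iff sum.distrib scaleR_sum_right)

lemma sum_UNIV_prod: "(\<Sum>p\<in>UNIV. f p) = (\<Sum>i\<in>UNIV. \<Sum>k\<in>UNIV. f (i, k))"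
  by (simp add: sum.cartesian_product UNIV_Times_UNIV[symmetric] del: UNIV_Times_UNIV)

lemma ptrace_B_one: "ptrace_B (mat 1 :: ('a::finite \<times> 'b::finite) cmat) = real CARD('b) *\<^sub>R mat 1"
  by (auto simp: ptrace_B_def mat_def vec_eq_iff scaleR_conv_of_real[where 'a = complex])

lemma ptrace_B_tensor_one:
  "ptrace_B (X \<otimes>\<^sub>M (mat 1 :: 'b::finite cmat)) = real CARD('b) *\<^sub>R X"
  by (auto simp: ptrace_B_def tensor_def mat_def vec_eq_iff scaleR_conv_of_real[where 'a = complex])

text \<open>The entries of \<open>X \<otimes>\<^sub>M mat 1\<close> vanish unless the second indices
  agree, so one inner sum collapses. With its mirror image below, this handles both halves of the
  anticommutator.\<close>

lemma ptrace_B_tensor_one_mult: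
  "ptrace_B ((X \<otimes>\<^sub>M (mat 1 :: 'b::finite cmat)) ** Y) = X ** ptrace_B Y"
proof -
  have "ptrace_B ((X \<otimes>\<^sub>M (mat 1 :: 'b cmat)) ** Y) $ i $ j = (X ** ptrace_B Y) $ i $ j" for i j
  proof -
    have "ptrace_B ((X \<otimes>\<^sub>M (mat 1 :: 'b cmat)) ** Y) $ i $ j
        = (\<Sum>k\<in>UNIV. \<Sum>l\<in>UNIV. X $ i $ l * Y $ (l, k) $ (j, k))"
      by (simp add: ptrace_B_def tensor_def mat_def matrix_matrix_mult_def sum_UNIV_prod
          if_distrib if_distribR cong: if_cong)
    also have "\<dots> = (\<Sum>l\<in>UNIV. \<Sum>k\<in>UNIV. X $ i $ l * Y $ (l, k) $ (j, k))"
      by (rule sum.swap)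
    finally show ?thesis
      by (simp add: ptrace_B_def matrix_matrix_mult_def sum_distrib_left)
  qed
  then show ?thesis by (simp add: vec_eq_iff)
qed

lemma ptrace_B_mult_tensor_one:
  "ptrace_B (Y ** (X \<otimes>\<^sub>M (mat 1 :: 'b::finite cmat))) = ptrace_B Y ** X"
proof -
  have "ptrace_B (Y ** (X \<otimes>\<^sub>M (mat 1 :: 'b cmat))) $ i $ j = (ptrace_B Y ** X) $ i $ j" for i j
  proof -
    have "ptrace_B (Y ** (X \<otimes>\<^sub>M (mat 1 :: 'b cmat))) $ i $ j
        = (\<Sum>k\<in>UNIV. \<Sum>l\<in>UNIV. Y $ (i, k) $ (l, k) * X $ l $ j)"
      by (simp add: ptrace_B_def tensor_def mat_def matrix_matrix_mult_def sum_UNIV_prod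
          if_distrib if_distribR cong: if_cong)
    also have "\<dots> = (\<Sum>l\<in>UNIV. \<Sum>k\<in>UNIV. Y $ (i, k) $ (l, k) * X $ l $ j)"
      by (rule sum.swap)
    finally show ?thesis
      by (simp add: ptrace_B_def matrix_matrix_mult_def sum_distrib_right)
  qed
  then show ?thesis by (simp add: vec_eq_iff)
qed

lemma hermitian_iff_entries: "hermitian Y \<longleftrightarrow> (\<forall>p q. cnj (Y $ p $ q) = Y $ q $ p)"
  by (auto simp: hermitian_def adj_def vec_eq_iff)

lemma hermitian_ptrace_B: "hermitian Y \<Longrightarrow> hermitian (ptrace_B Y)"
  by (simp add: hermitian_iff_entries ptrace_B_def)

lemma hermitian_tensor_one:
  "hermitian X \<Longrightarrow> hermitian (X \<otimes>\<^sub>M (mat 1 :: 'b::finite cmat))"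
  by (simp add: hermitian_iff_entries tensor_def mat_def)

lemma hermitian_scaleR: "hermitian X \<Longrightarrow> hermitian (r *\<^sub>R X)"
  unfolding hermitian_def by (simp add: linear_cmul[OF linear_adj])

lemma tensor_one_plus:
  "(mat 1 + t *\<^sub>R X) \<otimes>\<^sub>M (mat 1 :: 'b::finite cmat) = mat 1 + t *\<^sub>R (X \<otimes>\<^sub>M (mat 1 :: 'b cmat))"
  by (auto simp: tensor_def mat_def vec_eq_iff)

theorem proposition3p8:
  fixes X :: "'a::finite cmat"
    and Y :: "('a \<times> 'b::finite) cmat"
  assumes "hermitian X" and "hermitian Y"
  shows "(\<forall>\<^sub>F t in nhds (0::real). pos_def (mat 1 + t *\<^sub>R X) \<and> pos_def (mat 1 + t *\<^sub>R Y)) \<and>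
    (\<lambda>t::real. norm (ptrace_B (((mat 1 + t *\<^sub>R X) \<otimes>\<^sub>M (mat 1 :: 'b cmat)) \<star> (mat 1 + t *\<^sub>R Y))
                     - (mat 1 + t *\<^sub>R X) \<star> ptrace_B (mat 1 + t *\<^sub>R Y)))
      \<in> O[nhds 0](\<lambda>t. t ^ 3)"
proof
  show "\<forall>\<^sub>F t in nhds (0::real). pos_def (mat 1 + t *\<^sub>R X) \<and> pos_def (mat 1 + t *\<^sub>R Y)"
    by (intro eventually_conj eventually_pos_def assms)
  define d where "d = real CARD('b)"
  define X' where "X' = X \<otimes>\<^sub>M (mat 1 :: 'b cmat)"
  \<comment> \<open>Normalising by the traced-out dimension turns the traced factor into
    \<open>d\<close> times a perturbation of the identity.\<close>
  define Z where "Z = ptrace_B Y /\<^sub>R d"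
  have d: "0 < d" by (simp add: d_def)
  have Y_eq: "ptrace_B Y = d *\<^sub>R Z" using d by (simp add: Z_def)
  note ptrace_linear = linear_add[OF linear_ptrace_B] linear_diff[OF linear_ptrace_B]
    linear_cmul[OF linear_ptrace_B]
  have rhs: "ptrace_B (mat 1 + t *\<^sub>R Y) = d *\<^sub>R (mat 1 + t *\<^sub>R Z)" for t
    by (simp add: ptrace_linear ptrace_B_one d_def[symmetric] Y_eq algebra_simps)
  \<comment> \<open>Every term acquires the same factor \<open>d\<close>: from the traced identity
    where \<open>Y\<close> is absent, and from the definition of \<open>Z\<close> where
    \<open>Y\<close> occurs. Thus both sides of the claim share one quadratic polynomial.\<close>
  have second_order: "ptrace_B (mat 1 + t *\<^sub>R (X' + Y) + t\<^sup>2 *\<^sub>R (X' ** Y + Y ** X') /\<^sub>R 2)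
      = d *\<^sub>R (mat 1 + t *\<^sub>R (X + Z) + t\<^sup>2 *\<^sub>R (X ** Z + Z ** X) /\<^sub>R 2)" for t
    by (simp add: X'_def ptrace_linear ptrace_B_one ptrace_B_tensor_one ptrace_B_tensor_one_mult
        ptrace_B_mult_tensor_one d_def[symmetric] Y_eq scaleR_matrix_mult algebra_simps)
  have "vbigo 3 (\<lambda>t. (mat 1 + t *\<^sub>R X') \<star> (1 *\<^sub>R (mat 1 + t *\<^sub>R Y))
      - 1 *\<^sub>R (mat 1 + t *\<^sub>R (X' + Y) + t\<^sup>2 *\<^sub>R (X' ** Y + Y ** X') /\<^sub>R 2))"
    unfolding X'_def by (intro star_prod_expansion hermitian_tensor_one assms) simp
  from vbigo_linear[OF this linear_ptrace_B[unfolded linear_conv_bounded_linear]]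
  have "vbigo 3 (\<lambda>t. ptrace_B ((mat 1 + t *\<^sub>R X') \<star> (mat 1 + t *\<^sub>R Y))
      - d *\<^sub>R (mat 1 + t *\<^sub>R (X + Z) + t\<^sup>2 *\<^sub>R (X ** Z + Z ** X) /\<^sub>R 2))"
    by (simp only: linear_diff[OF linear_ptrace_B] second_order scaleR_one)
  moreover have "vbigo 3 (\<lambda>t. (mat 1 + t *\<^sub>R X) \<star> (d *\<^sub>R (mat 1 + t *\<^sub>R Z))
      - d *\<^sub>R (mat 1 + t *\<^sub>R (X + Z) + t\<^sup>2 *\<^sub>R (X ** Z + Z ** X) /\<^sub>R 2))"
    unfolding Z_def by (intro star_prod_expansion hermitian_scaleR hermitian_ptrace_B assms d)
  ultimately have "vbigo 3 (\<lambda>t. ptrace_B ((mat 1 + t *\<^sub>R X') \<star> (mat 1 + t *\<^sub>R Y))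
      - (mat 1 + t *\<^sub>R X) \<star> (d *\<^sub>R (mat 1 + t *\<^sub>R Z)))"
    using vbigo_diff by fastforce
  then show "(\<lambda>t::real. norm (ptrace_B (((mat 1 + t *\<^sub>R X) \<otimes>\<^sub>M (mat 1 :: 'b cmat)) \<star> (mat 1 + t *\<^sub>R Y))
                     - (mat 1 + t *\<^sub>R X) \<star> ptrace_B (mat 1 + t *\<^sub>R Y)))
      \<in> O[nhds 0](\<lambda>t. t ^ 3)"
    unfolding vbigo_def rhs tensor_one_plus X'_def .
qed

end
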